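(* Given $d_1,d_2,d_3>0$, let $f_{d_1,d_2,d_3}:[0,1]\to[0,1]$ be the map defined by $$f_{d_1,d_2,d_3}(z)=\begin{cases} -\frac12 z+\frac12 & \text{if } z\in[z_0,z_1)\\ -\frac12 z+1 & \text{if } z\in[z_1,z_2)\\ -\frac12 z+\frac12 & \text{if } z\in[z_2,z_3)\\ -\frac12 z+1 & \text{if } z\in[z_3,z_4]\end{cases}$$ where $$z_0=0,\quad z_1=\frac{1}{3(1+d_1)},\quad z_2=\frac{1}{3(1+d_2)}+\frac13,\quad z_3=\frac{1}{3(1+d_3)}+\frac23,\quad z_4=1.$$ Then the Poincaré map $F:\partial\Delta\to\partial\Delta$ of any switched server system with positive parameters $d_{ij}$ ($1\le i,j\le 3$, $i\ne j$) satisfying $$\frac{d_{13}}{d_{12}}=d_1,\qquad \frac{d_{21}}{d_{23}}=d_2,\qquad \frac{d_{32}}{d_{31}}=d_3$$ is topologically conjugate to $f_{d_1,d_2,d_3}$, that is, $f_{d_1,d_2,d_3}=\varphi^{-1}\circ F\circ\varphi$.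
   Context: Switched server system with parameters $d_{ij}>0$ ($1\le i,j\le 3$, $i\neq j$). There are three tanks $1,2,3$ and one server. The volume of fluid in tank $i$ at time $t\ge0$ is $v_i(t)\ge 0$; $\sum_i v_i(0)=1$. Fluid is delivered to every tank at constant rate $\frac13$ and is removed, at constant rate $1$, from the tank $l(t)\in\{1,2,3\}$ to which the server is connected at time $t$. Thus while the server is at tank $j$, $v_j$ decreases at rate $\frac23$, the other two volumes increase at rate $\frac13$, and $\sum_i v_i(t)=1$ for all $t$. The state is $\mathbf v(t)=(v_1(t),v_2(t),v_3(t))\in\Delta=\{(v_1,v_2,v_3): v_i\ge0,\ v_1+v_2+v_3=1\}$, and $\partial\Delta$ is the set of points of $\Delta$ with at least one zero coordinate. The function $l$ is right-continuous. At $t=0$ the server is connected to a non-empty tank. The times $0\le t_1<t_2<\cdots$ at which some tank is empty are the switching times. When tank $i$ is empty at a switching time $t$, the server moves to the tank $j\ne i$ with the largest scaled volume $d_{ij}v_j(t)$ (if two tanks are empty, it moves to the only non-empty tank). In case of a tie the server moves to tank $3$ if $i=1$, to tank $1$ if $i=2$, and to tank $2$ if $i=3$. The Poincaré map $F:\partial\Delta\to\partial\Delta$ sends the state at a switching time to the state at the next switching time. Let $\mathbf e_1=(1,0,0)$, $\mathbf e_2=(0,1,0)$, $\mathbf e_3=(0,0,1)$. The anticlockwise arc-length parametrization $\varphi:[0,1]\to\partial\Delta$ is $\varphi(t)=(1-3t)\mathbf e_2+3t\,\mathbf e_3$ for $t\in[0,\frac13)$, $\varphi(t)=(2-3t)\mathbf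 e_3+(3t-1)\mathbf e_1$ for $t\in[\frac13,\frac23)$, $\varphi(t)=(3-3t)\mathbf e_1+(3t-2)\mathbf e_2$ for $t\in[\frac23,1]$. It is injective except that $\varphi(0)=\varphi(1)=\mathbf e_2$, and $\mathbf e_2$ is not in the image of $F$, so $\varphi^{-1}\circ F\circ\varphi$ is well defined. Topological conjugacy of $F$ with an interval map is understood via $\varphi$. *)

theory Defs
  imports "HOL-Analysis.Analysis"
begin

text \<open>Tanks are indexed by the type \<open>3\<close>, whose elements are \<open>1\<close>, \<open>2\<close>, \<open>3\<close> (with \<open>3 = 0\<close>).\<close>

definition state_simplex :: "(real^3) set" where
  "state_simplex = {x. (\<forall>i. 0 \<le> x $ i) \<and> x $ 1 + x $ 2 + x $ 3 = 1}"

definition state_boundary :: "(real^3) set" where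
  "state_boundary = {x \<in> state_simplex. \<exists>i. x $ i = 0}"

definition switching_times :: "(real \<Rightarrow> real^3) \<Rightarrow> real set" where
  "switching_times v = {t. 0 \<le> t \<and> (\<exists>i. v t $ i = 0)}"

definition tie_tank :: "3 \<Rightarrow> 3" where
  "tie_tank i = (if i = 1 then 3 else if i = 2 then 1 else 2)"

text \<open>\<open>server_target d x i j\<close>: in state \<open>x\<close>, with tank \<open>i\<close> empty, the server moves to tank \<open>j\<close>.
  The diagonal entries \<open>d i i\<close> are never consulted.\<close>

definition server_target :: "(3 \<Rightarrow> 3 \<Rightarrow> real) \<Rightarrow> real^3 \<Rightarrow> 3 \<Rightarrow> 3 \<Rightarrow> bool" where
  "server_target d x i j \<longleftrightarrow> j \<noteq> i \<and>
     (if \<exists>k. k \<noteq> i \<and> x $ k = 0 then x $ j \<noteq> 0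
      else \<forall>k. k \<noteq> i \<and> k \<noteq> j \<longrightarrow>
             d i k * x $ k < d i j * x $ j \<or>
             (d i k * x $ k = d i j * x $ j \<and> j = tie_tank i))"

text \<open>An evolution of the switched server system on \<open>[0, \<infinity>)\<close>: volumes \<open>v\<close>, server position \<open>l\<close>.
  The integral clause is the fluid balance (inflow at rate \<open>1/3\<close> into every tank, outflow
  at rate \<open>1\<close> from the tank being served). The next two say that \<open>l\<close> is right-continuous (for the
  discrete topology on tanks) and that the server moves only at switching times, and the last is
  the switching rule; by right-continuity, \<open>l t\<close> at a switching time \<open>t\<close> is the tank to which
  the server moves. That the switching times form a sequence \<open>t\<^sub>1 < t\<^sub>2 < \<dots>\<close> without
  accumulation point is a consequence and is not assumed.\<close>

definition server_evolution ::
    "(3 \<Rightarrow> 3 \<Rightarrow> real) \<Rightarrow> (real \<Rightarrow> real^3) \<Rightarrow> (real \<Rightarrow> 3) \<Rightarrow> bool" where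
  "server_evolution d v l \<longleftrightarrow>
     (\<forall>t\<ge>0. v t \<in> state_simplex) \<and>
     0 < v 0 $ l 0 \<and>
     (\<forall>t\<ge>0. \<forall>i. ((\<lambda>s. 1/3 - (if l s = i then 1 else 0)) has_integral (v t $ i - v 0 $ i)) {0..t}) \<and>
     (\<forall>t\<ge>0. \<forall>\<^sub>F s in at_right t. l s = l t) \<and>
     (\<forall>s t. 0 \<le> s \<and> s < t \<and> {s<..t} \<inter> switching_times v = {} \<longrightarrow> l s = l t) \<and>
     (\<forall>t\<in>switching_times v. \<forall>i. v t $ i = 0 \<longrightarrow> server_target d (v t) i (l t))"

definition consecutive_switching_times :: "(real \<Rightarrow> real^3) \<Rightarrow> real \<Rightarrow> real \<Rightarrow> bool" where
  "consecutive_switching_times v t t' \<longleftrightarrow>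
     t \<in> switching_times v \<and> t' \<in> switching_times v \<and> t < t' \<and>
     {t<..<t'} \<inter> switching_times v = {}"

definition poincare_map :: "(3 \<Rightarrow> 3 \<Rightarrow> real) \<Rightarrow> real^3 \<Rightarrow> real^3" where
  "poincare_map d x = (THE y. \<exists>v l t t'. server_evolution d v l \<and>
     consecutive_switching_times v t t' \<and> v t = x \<and> v t' = y)"

definition phi :: "real \<Rightarrow> real^3" where
  "phi t =
     (if t \<in> {0..<1/3} then (1 - 3*t) *\<^sub>R axis 2 1 + (3*t) *\<^sub>R axis 3 1
      else if t \<in> {1/3..<2/3} then (2 - 3*t) *\<^sub>R axis 3 1 + (3*t - 1) *\<^sub>R axis 1 1
      else if t \<in> {2/3..1} then (3 - 3*t) *\<^sub>R axis 1 1 + (3*t - 2) *\<^sub>R axis 2 1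
      else undefined)"

text \<open>Since \<open>phi 0 = phi 1 = axis 2 1\<close>, the value at \<open>axis 2 1\<close> is meaningless.\<close>

definition phi_inv :: "real^3 \<Rightarrow> real" where
  "phi_inv = the_inv_into {0..1} phi"

definition f_map :: "real \<Rightarrow> real \<Rightarrow> real \<Rightarrow> real \<Rightarrow> real" where
  "f_map d1 d2 d3 z =
     (let z0 = 0;
          z1 = 1 / (3 * (1 + d1));
          z2 = 1 / (3 * (1 + d2)) + 1/3;
          z3 = 1 / (3 * (1 + d3)) + 2/3;
          z4 = 1
      in if z \<in> {z0..<z1} then - (1/2) * z + 1/2
         else if z \<in> {z1..<z2} then - (1/2) * z + 1
         else if z \<in> {z2..<z3} then - (1/2) * z + 1/2
         else if z \<in> {z3..z4} then - (1/2) * z + 1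
         else undefined)"

text \<open>Topological conjugacy via \<open>phi\<close> of a map on the boundary of the simplex with a map of the
  unit interval. That \<open>axis 2 1\<close> is not attained makes \<open>phi_inv \<circ> F \<circ> phi\<close> well defined.\<close>

definition conjugate_via_phi :: "(real^3 \<Rightarrow> real^3) \<Rightarrow> (real \<Rightarrow> real) \<Rightarrow> bool" where
  "conjugate_via_phi F f \<longleftrightarrow>
     F \<in> state_boundary \<rightarrow> state_boundary - {axis 2 1} \<and>
     f \<in> {0..1} \<rightarrow> {0..1} \<and>
     (\<forall>z\<in>{0..1}. f z = (phi_inv \<circ> F \<circ> phi) z)"

end

theory Submission
  imports Defs
begin

text \<open>Between switching times the served tank \<open>j\<close> is the only one that can become empty, which
  happens after time \<open>3/2 * v\<^sub>j\<close>; this determines the next boundary state. So that the description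
  in \<open>poincare_map\<close> is not vacuous, an evolution on all of \<open>[0, \<infinity>)\<close> is needed from every boundary
  state. It is obtained by concatenating these linear pieces: the tank chosen has volume bounded
  below by a positive constant depending only on the weights, so the switching times are unbounded.
  On each side of the triangle the switching rule compares two linear functions of the parameter,
  and their crossing points are the discontinuities of the interval map.\<close>

section \<open>The switching rule and the draining of one tank\<close>

definition server_choice :: "(3 \<Rightarrow> 3 \<Rightarrow> real) \<Rightarrow> real^3 \<Rightarrow> 3 \<Rightarrow> bool" where
  "server_choice d x j \<longleftrightarrow> (\<forall>i. x $ i = 0 \<longrightarrow> server_target d x i j)"

definition drift :: "3 \<Rightarrow> real^3" where
  "drift j = (\<chi> i. 1/3 - (if j = i then 1 else 0))"

definition drain :: "3 \<Rightarrow> real^3 \<Rightarrow> real^3" where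
  "drain j x = x + (3/2 * x $ j) *\<^sub>R drift j"

lemma ex_3: "(\<exists>i::3. P i) \<longleftrightarrow> P 1 \<or> P 2 \<or> P 3"
  by (metis exhaust_3)

lemma third_tank:
  fixes i j :: 3 and x :: "real^3"
  assumes "j \<noteq> i"
  shows "\<exists>k. k \<noteq> i \<and> k \<noteq> j \<and> (\<forall>l. l = i \<or> l = j \<or> l = k) \<and>
           x $ 1 + x $ 2 + x $ 3 = x $ i + x $ j + x $ k"
  using assms exhaust_3[of i] exhaust_3[of j] by (auto simp: ex_3 forall_3)

lemma drift_nth: "drift j $ i = (if j = i then - 2/3 else 1/3)"
  by (simp add: drift_def)

lemma state_boundary_iff:
  "x \<in> state_boundary \<longleftrightarrow>
     0 \<le> x $ 1 \<and> 0 \<le> x $ 2 \<and> 0 \<le> x $ 3 \<and> x $ 1 + x $ 2 + x $ 3 = 1 \<and>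
     (x $ 1 = 0 \<or> x $ 2 = 0 \<or> x $ 3 = 0)"
  by (simp add: state_boundary_def state_simplex_def forall_3 ex_3)

text \<open>Two tanks cannot each have the strictly larger scaled volume, and in a tie only
  \<open>tie_tank i\<close> qualifies. With a second empty tank, at most one tank is
  non-empty.\<close>

lemma server_target_unique:
  assumes "x \<in> state_simplex" "x $ i = 0" "server_target d x i j" "server_target d x i k"
  shows "j = k"
  using assms exhaust_3[of i] exhaust_3[of j] exhaust_3[of k]
  by (auto simp: server_target_def state_simplex_def forall_3 ex_3 tie_tank_def split: if_splits)

lemma server_choice_unique:
  assumes "x \<in> state_boundary" "server_choice d x j" "server_choice d x k"
  shows "j = k"
  using assms server_target_unique unfolding server_choice_def state_boundary_def by blast

text \<open>Inside a side only one tank is empty, and the larger scaled volume or the tie rule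
  decides. At a vertex the rule must hold for both empty tanks at once, and the full tank satisfies
  both.\<close>

lemma server_choice_exists:
  assumes "x \<in> state_boundary"
  shows "\<exists>j. server_choice d x j"
  using assms
  by (auto simp: server_choice_def server_target_def state_boundary_iff forall_3 ex_3 tie_tank_def)

text \<open>If tank \<open>i\<close> is empty and \<open>j\<close> is preferred to \<open>k\<close>,
  then \<open>x $ k = 1 - x $ j\<close> turns the comparison of scaled volumes into
  \<open>d i k / (d i j + d i k) \<le> x $ j\<close>. Only finitely many such quotients occur, so
  the bound is uniform in the state.\<close>

lemma server_choice_pos_lower_bound:
  assumes pos: "\<And>i j. i \<noteq> j \<Longrightarrow> d i j > 0"
  shows "\<exists>c>0. \<forall>x j. x \<in> state_boundary \<longrightarrow> server_choice d x j \<longrightarrow> c \<le> x $ j"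
proof -
  define S :: "(3 \<times> 3 \<times> 3) set" where "S = {(i, j, k). i \<noteq> j \<and> i \<noteq> k}"
  \<comment> \<open>The inserted 1 covers the vertices, where the chosen tank holds all the fluid.
    Triples with \<open>j = k\<close> contribute 1/2.\<close>
  define c where "c = Min (insert 1 ((\<lambda>(i, j, k). d i k / (d i j + d i k)) ` S))"
  have c1: "c \<le> 1" unfolding c_def by (intro Min_le) auto
  have c2: "c \<le> d i k / (d i j + d i k)" if "i \<noteq> j" "i \<noteq> k" for i j k
    unfolding c_def using that by (intro Min_le) (auto simp: S_def image_iff)
  have "c > 0"
    unfolding c_def using pos by (auto simp: S_def intro!: divide_pos_pos add_pos_pos)
  moreover have "c \<le> x $ j" if x: "x \<in> state_boundary" and j: "server_choice d x j" for x j
  proof -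
    obtain i where i: "x $ i = 0" using x by (auto simp: state_boundary_def)
    then have t: "server_target d x i j" using j by (simp add: server_choice_def)
    then have "j \<noteq> i" by (simp add: server_target_def)
    then obtain k where k: "k \<noteq> i" "k \<noteq> j" "\<And>l. l = i \<or> l = j \<or> l = k"
      and U: "x $ 1 + x $ 2 + x $ 3 = x $ i + x $ j + x $ k"
      using third_tank[of j i x] by metis
    have xk: "x $ k = 1 - x $ j"
      using U i x by (simp add: state_boundary_iff)
    show ?thesis
    proof (cases "\<exists>k. k \<noteq> i \<and> x $ k = 0")
      case True
      then have "x $ j \<noteq> 0" using t by (simp add: server_target_def)
      with True have "x $ k = 0"
        using k(3) by metis
      with xk c1 show ?thesis by simp
    next
      case False
      then have "d i k * x $ k < d i j * x $ j \<or> d i k * x $ k = d i j * x $ j"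
        using t k(1,2) unfolding server_target_def by (simp only: if_False) blast
      then have "d i k * x $ k \<le> d i j * x $ j" by linarith
      then have "d i k / (d i j + d i k) \<le> x $ j"
        using pos[of i k] pos[of i j] k(1) \<open>j \<noteq> i\<close>
        by (simp add: pos_divide_le_eq add_pos_pos xk algebra_simps)
      with c2[of i j k] k(1) \<open>j \<noteq> i\<close> show ?thesis by simp
    qed
  qed
  ultimately show ?thesis by blast
qed

lemma server_choice_pos:
  assumes "x \<in> state_boundary" "server_choice d x j"
    and "\<And>i j. i \<noteq> j \<Longrightarrow> d i j > 0"
  shows "x $ j > 0"
  using server_choice_pos_lower_bound[of d] assms by (meson less_le_trans)

lemma drain_in_boundary:
  assumes "x \<in> state_boundary"
  shows "drain j x \<in> state_boundary"
  using exhaust_3[of j] assms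
  by (elim disjE; simp add: state_boundary_iff drain_def drift_nth)

section \<open>Evolutions between consecutive switching times\<close>

lemma has_integral_rate_constant:
  fixes l :: "real \<Rightarrow> 3"
  assumes "a \<le> b" "\<And>s. a \<le> s \<Longrightarrow> s < b \<Longrightarrow> l s = j"
  shows "((\<lambda>s. 1/3 - (if l s = i then 1 else 0)) has_integral ((b - a) * drift j $ i)) {a..b}"
\<comment> \<open>At \<open>b\<close> the server may already have moved; a single point does not
  change the integral.\<close>
proof (rule has_integral_spike_finite[where S = "{b}" and f = "\<lambda>s. drift j $ i"])
  show "1/3 - (if l s = i then 1 else 0) = drift j $ i" if s: "s \<in> {a..b} - {b}" for s
  proof -
    have "l s = j" using s by (intro assms(2)) auto
    then show ?thesis by (simp add: drift_def)
  qed
  show "((\<lambda>s. drift j $ i) has_integral ((b - a) * drift j $ i)) {a..b}"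
    using has_integral_const_real[of "drift j $ i" a b] assms(1)
    by (simp only: content_real real_scaleR_def)
qed simp

lemma server_evolutionD:
  assumes "server_evolution d v l"
  shows "0 \<le> t \<Longrightarrow> v t \<in> state_simplex"
    and "0 \<le> t \<Longrightarrow>
      ((\<lambda>s. 1/3 - (if l s = i then 1 else 0)) has_integral (v t $ i - v 0 $ i)) {0..t}"
    and "0 \<le> s \<Longrightarrow> s < t \<Longrightarrow> {s<..t} \<inter> switching_times v = {} \<Longrightarrow> l s = l t"
    and "t \<in> switching_times v \<Longrightarrow> v t $ i = 0 \<Longrightarrow> server_target d (v t) i (l t)"
  using assms unfolding server_evolution_def by blast+

text \<open>The uniqueness half of the description in \<open>poincare_map\<close>: it covers every
  evolution and every consecutive pair, so the next state depends on the present one alone.\<close>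

lemma server_evolution_step:
  assumes ev: "server_evolution d v l" and cons: "consecutive_switching_times v t t'"
  shows "server_choice d (v t) (l t)" "v t' = drain (l t) (v t)"
proof -
  let ?j = "l t"
  have t: "t \<in> switching_times v" "t' \<in> switching_times v" "t < t'" "0 \<le> t"
    and gap: "{t<..<t'} \<inter> switching_times v = {}"
    using cons by (auto simp: consecutive_switching_times_def switching_times_def)
  show "server_choice d (v t) ?j"
    using server_evolutionD(4)[OF ev t(1)] by (simp add: server_choice_def)
  have const: "l s = ?j" if "t \<le> s" "s < t'" for s
  proof (cases "s = t")
    case False
    then have "{t<..s} \<inter> switching_times v = {}" using gap that(2) by (force simp: disjoint_iff)
    moreover have "t < s" using False that(1) by simp
    ultimately have "l t = l s" by (intro server_evolutionD(3)[OF ev t(4)])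
    then show ?thesis by simp
  qed simp
  \<comment> \<open>The fluid balance starts at time 0, so the increment over \<open>{t..t'}\<close>
    comes from comparing two integrals over \<open>{0..t'}\<close>.\<close>
  have inc: "v t' $ i = v t $ i + (t' - t) * drift ?j $ i" for i
  proof -
    let ?g = "\<lambda>s. 1/3 - (if l s = i then 1 else 0) :: real"
    have I: "(?g has_integral (v t $ i - v 0 $ i)) {0..t}" "(?g has_integral (v t' $ i - v 0 $ i)) {0..t'}"
      using t(3,4) by (intro server_evolutionD(2)[OF ev]; simp)+
    have "(?g has_integral ((t' - t) * drift ?j $ i)) {t..t'}"
      using less_imp_le[OF t(3)] const by (rule has_integral_rate_constant)
    then have "(?g has_integral (v t $ i - v 0 $ i + (t' - t) * drift ?j $ i)) {0..t'}"
      by (rule has_integral_combine[OF t(4) less_imp_le[OF t(3)] I(1)])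
    then have "v t $ i - v 0 $ i + (t' - t) * drift ?j $ i = v t' $ i - v 0 $ i"
      using I(2) by (rule has_integral_unique)
    then show ?thesis by simp
  qed
  have nn: "0 \<le> v t $ i" for i
    using server_evolutionD(1)[OF ev t(4)] by (simp add: state_simplex_def)
  obtain i where i: "v t' $ i = 0" using t(2) by (auto simp: switching_times_def)
  have "i = ?j"
  proof (rule ccontr)
    assume "i \<noteq> ?j"
    then have "v t' $ i = v t $ i + (t' - t) / 3" using inc[of i] by (simp add: drift_nth)
    also have "\<dots> > 0" using nn[of i] t(3) by (intro add_nonneg_pos) simp_all
    finally show False using i by simp
  qed
  with i inc[of i] have "t' - t = 3/2 * v t $ ?j" by (simp add: drift_nth)
  with inc show "v t' = drain ?j (v t)"
    by (simp add: vec_eq_iff drain_def)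
qed

section \<open>Construction of an evolution from a given boundary state\<close>

locale server_orbit =
  fixes d :: "3 \<Rightarrow> 3 \<Rightarrow> real" and x0 :: "real^3"
  assumes weight_pos: "\<And>i j. i \<noteq> j \<Longrightarrow> d i j > 0"
    and x0: "x0 \<in> state_boundary"
begin

definition choice :: "real^3 \<Rightarrow> 3" where
  "choice x = (SOME j. server_choice d x j)"

definition state :: "nat \<Rightarrow> real^3" where
  "state n = ((\<lambda>x. drain (choice x) x) ^^ n) x0"

definition serve :: "nat \<Rightarrow> 3" where
  "serve n = choice (state n)"

definition time :: "nat \<Rightarrow> real" where
  "time n = (\<Sum>k<n. 3/2 * state k $ serve k)"

text \<open>The strict inequality puts \<open>time n\<close> into phase \<open>n\<close>, so that at
  a switching time \<open>position\<close> already names the new tank, as right-continuity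
  demands.\<close>

definition phase :: "real \<Rightarrow> nat" where
  "phase t = (LEAST n. t < time (Suc n))"

definition position :: "real \<Rightarrow> 3" where
  "position t = serve (phase t)"

definition volume :: "real \<Rightarrow> real^3" where
  "volume t = state (phase t) + (t - time (phase t)) *\<^sub>R drift (position t)"

lemma state_0 [simp]: "state 0 = x0"
  and state_Suc: "state (Suc n) = drain (serve n) (state n)"
  by (simp_all add: state_def serve_def)

lemma state_boundary: "state n \<in> state_boundary"
  by (induction n) (simp_all add: x0 state_Suc drain_in_boundary)

lemma serve_choice: "server_choice d (state n) (serve n)"
  unfolding serve_def choice_def using server_choice_exists[OF state_boundary] by (rule someI_ex)

lemma time_0 [simp]: "time 0 = 0"
  and time_Suc: "time (Suc n) = time n + 3/2 * state n $ serve n"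
  by (simp_all add: time_def)

lemma strict_mono_time: "strict_mono time"
  using server_choice_pos[OF state_boundary serve_choice weight_pos]
  by (intro strict_mono_Suc_iff[THEN iffD2]) (simp add: time_Suc)

text \<open>Rules out accumulation of the switching times, which would leave the evolution undefined
  from some time on. Each phase lasts at least \<open>3/2 * c\<close>.\<close>

lemma time_unbounded: "\<exists>n. t < time n"
proof -
  obtain c where c: "c > 0" "\<And>x j. x \<in> state_boundary \<Longrightarrow> server_choice d x j \<Longrightarrow> c \<le> x $ j"
    using server_choice_pos_lower_bound[of d] weight_pos by blast
  have "real n * c \<le> time n" for n
  proof (induction n)
    case (Suc n)
    have "c \<le> state n $ serve n" using c(2) state_boundary serve_choice by blast
    with Suc c(1) show ?case by (simp add: time_Suc algebra_simps)
  qed simp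
  moreover obtain n where "t < real n * c" using reals_Archimedean3[OF c(1)] by blast
  ultimately show ?thesis by (meson less_le_trans)
qed

lemma phase_eqI:
  assumes "time n \<le> t" "t < time (Suc n)"
  shows "phase t = n"
  unfolding phase_def
proof (rule Least_equality)
  fix m assume "t < time (Suc m)"
  with assms(1) have "time n < time (Suc m)" by simp
  then show "n \<le> m" using strict_mono_less[OF strict_mono_time] by simp
qed (use assms in simp)

lemma phase_bounds:
  assumes "0 \<le> t"
  shows "time (phase t) \<le> t" "t < time (Suc (phase t))"
proof -
  obtain n where "t < time n" using time_unbounded by blast
  then have ex: "t < time (Suc n)" using strict_monoD[OF strict_mono_time, of n "Suc n"] by simp
  then show "t < time (Suc (phase t))" unfolding phase_def by (rule LeastI)
  show "time (phase t) \<le> t"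
  proof (cases "phase t")
    case (Suc m)
    then have "\<not> t < time (Suc m)" unfolding phase_def by (intro not_less_Least) simp
    with Suc show ?thesis by simp
  qed (use assms in simp)
qed

lemma phase_time [simp]: "phase (time n) = n"
  using strict_mono_time by (intro phase_eqI) (auto simp: strict_mono_Suc_iff)

lemma volume_time [simp]: "volume (time n) = state n"
  by (simp add: volume_def)

lemma volume_nth:
  "volume t $ i = state (phase t) $ i + (t - time (phase t)) * drift (serve (phase t)) $ i"
  by (simp add: volume_def position_def)

text \<open>The entries of a drift sum to 0, and a phase lasts just as long as the served tank needs
  to run dry, while the other two tanks fill.\<close>

lemma volume_simplex:
  assumes "0 \<le> t"
  shows "volume t \<in> state_simplex"
  using phase_bounds[OF assms] state_boundary[of "phase t"] exhaust_3[of "serve (phase t)"]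
  by (auto simp: state_simplex_def forall_3 volume_nth drift_nth state_boundary_iff time_Suc field_simps)

lemma switching_times_volume: "switching_times volume = range time"
proof (intro set_eqI iffI)
  fix t assume "t \<in> switching_times volume"
  then obtain i where t: "0 \<le> t" and i: "volume t $ i = 0" by (auto simp: switching_times_def)
  note b = phase_bounds[OF t]
  have nn: "0 \<le> state (phase t) $ i"
    using state_boundary[of "phase t"] by (simp add: state_boundary_def state_simplex_def)
  have "t = time (phase t)"
  proof (cases "serve (phase t) = i")
    \<comment> \<open>The served tank would be empty only at \<open>time (Suc (phase t))\<close>,
      which lies outside the phase, so this case is contradictory.\<close>
    case True
    with i b show ?thesis by (simp add: volume_nth drift_nth time_Suc)
  next
    case False
    with i have "state (phase t) $ i + (t - time (phase t)) / 3 = 0"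
      by (simp add: volume_nth drift_nth)
    with b(1) nn show ?thesis by (simp add: add_nonneg_eq_0_iff)
  qed
  then show "t \<in> range time" by blast
next
  fix t assume "t \<in> range time"
  then obtain n where "t = time n" by blast
  moreover have "0 \<le> time n"
    using strict_mono_less_eq[OF strict_mono_time, of 0 n] by simp
  ultimately show "t \<in> switching_times volume"
    using state_boundary[of n] by (auto simp: switching_times_def state_boundary_def)
qed

text \<open>Allowing \<open>t = time (Suc n)\<close> lets the induction hypothesis reach the start
  of the next phase, where the next linear piece is attached.\<close>

lemma position_integral:
  assumes "time n \<le> t" "t \<le> time (Suc n)"
  shows "((\<lambda>s. 1/3 - (if position s = i then 1 else 0)) has_integral
           (state n $ i + (t - time n) * drift (serve n) $ i - x0 $ i)) {0..t}"
  using assms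
proof (induction n arbitrary: t)
  case 0
  have "((\<lambda>s. 1/3 - (if position s = i then 1 else 0)) has_integral ((t - 0) * drift (serve 0) $ i)) {0..t}"
    using 0 by (intro has_integral_rate_constant) (auto simp: position_def phase_eqI[of 0])
  then show ?case by simp
next
  case (Suc n)
  let ?g = "\<lambda>s. 1/3 - (if position s = i then 1 else 0) :: real"
  have m: "time n \<le> time (Suc n)" "0 \<le> time (Suc n)"
    using strict_mono_less_eq[OF strict_mono_time, of n "Suc n"]
      strict_mono_less_eq[OF strict_mono_time, of 0 "Suc n"] by simp_all
  have "(?g has_integral (state n $ i + (time (Suc n) - time n) * drift (serve n) $ i - x0 $ i)) {0..time (Suc n)}"
    using m by (intro Suc.IH) auto
  \<comment> \<open>At its right end the linear piece of phase \<open>n\<close> takes the value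
    \<open>drain (serve n) (state n)\<close>.\<close>
  then have "(?g has_integral (state (Suc n) $ i - x0 $ i)) {0..time (Suc n)}"
    by (simp add: state_Suc drain_def time_Suc)
  moreover have "(?g has_integral ((t - time (Suc n)) * drift (serve (Suc n)) $ i)) {time (Suc n)..t}"
    using Suc.prems by (intro has_integral_rate_constant) (auto simp: position_def phase_eqI[of "Suc n"])
  ultimately have "(?g has_integral (state (Suc n) $ i - x0 $ i + (t - time (Suc n)) * drift (serve (Suc n)) $ i)) {0..t}"
    using m Suc.prems by (intro has_integral_combine[of 0 "time (Suc n)" t]) auto
  then show ?case by (simp add: algebra_simps)
qed

lemma server_evolution_orbit: "server_evolution d volume position"
  unfolding server_evolution_def
proof (intro conjI allI impI ballI)
  show "volume t \<in> state_simplex" if "0 \<le> t" for t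
    using that by (rule volume_simplex)
  have v0: "volume 0 = x0" and p0: "phase 0 = 0"
    using volume_time[of 0] phase_time[of 0] by simp_all
  show "0 < volume 0 $ position 0"
    using server_choice_pos[OF state_boundary serve_choice weight_pos, of 0]
    by (simp add: v0 p0 position_def)
  show "((\<lambda>s. 1/3 - (if position s = i then 1 else 0)) has_integral (volume t $ i - volume 0 $ i)) {0..t}"
    if "0 \<le> t" for t i
    using position_integral[of "phase t" t i] phase_bounds[OF that] by (simp add: volume_nth[of t] v0)
  show "\<forall>\<^sub>F s in at_right t. position s = position t" if "0 \<le> t" for t
  proof -
    have "\<forall>\<^sub>F s in at_right t. s \<in> {t<..<time (Suc (phase t))}"
      using phase_bounds[OF that] by (intro eventually_at_right_real)
    then show ?thesis
    proof eventually_elim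
      case (elim s)
      then have "phase s = phase t" using phase_bounds[OF that] by (intro phase_eqI) auto
      then show ?case by (simp add: position_def)
    qed
  qed
  show "position s = position t"
    if "0 \<le> s \<and> s < t \<and> {s<..t} \<inter> switching_times volume = {}" for s t
  proof -
    \<comment> \<open>The right-hand side is a switching time after \<open>s\<close>, so it cannot
      lie in \<open>{s<..t}\<close>.\<close>
    have "t < time (Suc (phase s))"
      using that phase_bounds(2)[of s] unfolding switching_times_volume by force
    then have "phase t = phase s" using that phase_bounds(1)[of s] by (intro phase_eqI) auto
    then show ?thesis by (simp add: position_def)
  qed
  show "server_target d (volume t) i (position t)"
    if t: "t \<in> switching_times volume" "volume t $ i = 0" for t i
  proof -
    obtain n where "t = time n" using t(1) unfolding switching_times_volume by blast
    with t(2) serve_choice[of n] show ?thesis by (simp add: server_choice_def position_def)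
  qed
qed

lemma consecutive_time: "consecutive_switching_times volume (time 0) (time (Suc 0))"
proof -
  have "time n \<notin> {time 0<..<time (Suc 0)}" for n
    using strict_mono_less[OF strict_mono_time] by (metis greaterThanLessThan_iff less_Suc0 less_irrefl)
  then show ?thesis
    using strict_mono_less[OF strict_mono_time, of 0 "Suc 0"]
    unfolding consecutive_switching_times_def switching_times_volume by blast
qed

end

text \<open>The orbit started at \<open>x\<close> has its first two switching times at states
  \<open>x\<close> and \<open>drain j x\<close>, which gives existence;
  \<open>server_evolution_step\<close> and uniqueness of the choice exclude any other value.\<close>

lemma poincare_map_eq:
  assumes "\<And>i j. i \<noteq> j \<Longrightarrow> d i j > 0" "x \<in> state_boundary" "server_choice d x j"
  shows "poincare_map d x = drain j x"
  unfolding poincare_map_def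
proof (rule the_equality)
  interpret server_orbit d x using assms(1,2) by unfold_locales
  have "serve 0 = j"
    using server_choice_unique[OF assms(2) _ assms(3)] serve_choice[of 0] by simp
  then have "volume (time (Suc 0)) = drain j x"
    by (simp add: state_Suc)
  moreover have "volume (time 0) = x"
    by (simp only: volume_time state_0)
  ultimately show "\<exists>v l t t'. server_evolution d v l \<and>
      consecutive_switching_times v t t' \<and> v t = x \<and> v t' = drain j x"
    using server_evolution_orbit consecutive_time by blast
next
  fix y
  assume "\<exists>v l t t'. server_evolution d v l \<and> consecutive_switching_times v t t' \<and> v t = x \<and> v t' = y"
  then show "y = drain j x"
    using server_evolution_step server_choice_unique[OF assms(2) _ assms(3)] by metis
qed

section \<open>The parametrization of the boundary\<close>

lemma phi_nth_1: "0 \<le> z \<Longrightarrow> z \<le> 1/3 \<Longrightarrow> phi z $ 1 = 0 \<and> phi z $ 2 = 1 - 3*z \<and> phi z $ 3 = 3*z"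
  by (cases "z = 1/3") (auto simp: phi_def axis_def)

lemma phi_nth_2: "1/3 \<le> z \<Longrightarrow> z \<le> 2/3 \<Longrightarrow> phi z $ 1 = 3*z - 1 \<and> phi z $ 2 = 0 \<and> phi z $ 3 = 2 - 3*z"
  by (cases "z = 2/3") (auto simp: phi_def axis_def)

lemma phi_nth_3: "2/3 \<le> z \<Longrightarrow> z \<le> 1 \<Longrightarrow> phi z $ 1 = 3 - 3*z \<and> phi z $ 2 = 3*z - 2 \<and> phi z $ 3 = 0"
  by (auto simp: phi_def axis_def)

lemma unit_interval_thirds:
  fixes z :: real
  assumes "0 \<le> z" "z \<le> 1"
  obtains "0 \<le> z" "z \<le> 1/3" | "1/3 \<le> z" "z \<le> 2/3" | "2/3 \<le> z" "z \<le> 1"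
  using assms by linarith

text \<open>The sides are taken closed, since the formulas of neighbouring sides agree at their
  common corner.\<close>

lemma phi_cases:
  assumes "0 \<le> z" "z \<le> 1"
  obtains "z \<le> 1/3" "phi z $ 1 = 0" "phi z $ 2 = 1 - 3*z" "phi z $ 3 = 3*z"
    | "1/3 \<le> z" "z \<le> 2/3" "phi z $ 1 = 3*z - 1" "phi z $ 2 = 0" "phi z $ 3 = 2 - 3*z"
    | "2/3 \<le> z" "phi z $ 1 = 3 - 3*z" "phi z $ 2 = 3*z - 2" "phi z $ 3 = 0"
  using assms phi_nth_1[of z] phi_nth_2[of z] phi_nth_3[of z] by linarith

lemma phi_in_boundary:
  assumes "0 \<le> z" "z \<le> 1"
  shows "phi z \<in> state_boundary"
  by (rule phi_cases[OF assms]) (use assms in \<open>simp_all add: state_boundary_iff\<close>)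

lemma phi_surj:
  assumes "x \<in> state_boundary"
  obtains z where "0 \<le> z" "z \<le> 1" "phi z = x"
proof -
  consider "x $ 1 = 0" | "x $ 2 = 0" | "x $ 3 = 0" using assms by (auto simp: state_boundary_iff)
  then show thesis
  proof cases
    \<comment> \<open>On each side the parameter is read off from the coordinate that grows along
      it: \<open>3*z\<close>, \<open>3*z - 1\<close> and \<open>3*z - 2\<close> in turn.\<close>
    case 1
    then show thesis using assms phi_nth_1[of "x $ 3 / 3"]
      by (intro that[of "x $ 3 / 3"]) (auto simp: state_boundary_iff vec_eq_iff forall_3 field_simps)
  next
    case 2
    then show thesis using assms phi_nth_2[of "(1 + x $ 1) / 3"]
      by (intro that[of "(1 + x $ 1) / 3"]) (auto simp: state_boundary_iff vec_eq_iff forall_3 field_simps)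
  next
    case 3
    then show thesis using assms phi_nth_3[of "(2 + x $ 2) / 3"]
      by (intro that[of "(2 + x $ 2) / 3"]) (auto simp: state_boundary_iff vec_eq_iff forall_3 field_simps)
  qed
qed

text \<open>The only coincidence is \<open>phi 0 = phi 1\<close>, so one interior parameter
  suffices. This both inverts \<open>phi\<close> at \<open>w\<close> and separates
  \<open>phi w\<close> from \<open>axis 2 1\<close>.\<close>

lemma phi_inj:
  assumes "0 < w" "w < 1" "0 \<le> z" "z \<le> 1" "phi z = phi w"
  shows "z = w"
proof -
  have w: "0 \<le> w" "w \<le> 1" using assms by simp_all
  show ?thesis
    by (rule phi_cases[OF w]; rule phi_cases[OF assms(3,4), unfolded assms(5)])
      (use assms(1,2) in linarith)+
qed

lemma phi_inv_phi:
  assumes "0 < w" "w < 1"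
  shows "phi_inv (phi w) = w"
  unfolding phi_inv_def the_inv_into_def
  using assms phi_inj[OF assms] by (intro the_equality) auto

section \<open>The switching rule in terms of the parameter\<close>

lemma less_third_quotient_iff:
  fixes a b u :: real
  assumes "a > 0" "b > 0"
  shows "u / 3 < 1 / (3 * (1 + a / b)) \<longleftrightarrow> a * u < b * (1 - u)"
proof -
  \<comment> \<open>The scaled volumes \<open>a * u\<close> and \<open>b * (1 - u)\<close> cross at
    \<open>u = b / (a + b)\<close>; the factor 1/3 is the length of a side.\<close>
  have "1 / (3 * (1 + a / b)) = (b / (a + b)) / 3"
    using assms by (simp add: field_simps)
  then have "u / 3 < 1 / (3 * (1 + a / b)) \<longleftrightarrow> u < b / (a + b)"
    by (simp only: divide_less_cancel) simp
  also have "\<dots> \<longleftrightarrow> a * u < b * (1 - u)"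
    using assms by (simp add: pos_less_divide_eq algebra_simps)
  finally show ?thesis .
qed

text \<open>At the crossing itself the tie goes to tank 3, in agreement with the strict inequality.
  The corners lie on the correct sides of the threshold, which is strictly between 0 and
  1/3.\<close>

lemma server_choice_phi_1:
  assumes "0 \<le> z" "z \<le> 1/3" "d 1 2 > 0" "d 1 3 > 0"
  shows "server_choice d (phi z) (if z < 1 / (3 * (1 + d 1 3 / d 1 2)) then 2 else 3)"
proof -
  have "z < 1 / (3 * (1 + d 1 3 / d 1 2)) \<longleftrightarrow> d 1 3 * (3*z) < d 1 2 * (1 - 3*z)"
    using less_third_quotient_iff[of "d 1 3" "d 1 2" "3*z"] assms by simp
  then show ?thesis using phi_nth_1[OF assms(1,2)] assms
    by (auto simp: server_choice_def server_target_def forall_3 ex_3 tie_tank_def)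
qed

lemma server_choice_phi_2:
  assumes "1/3 \<le> z" "z \<le> 2/3" "d 2 1 > 0" "d 2 3 > 0"
  shows "server_choice d (phi z) (if z < 1 / (3 * (1 + d 2 1 / d 2 3)) + 1/3 then 3 else 1)"
proof -
  have "z < 1 / (3 * (1 + d 2 1 / d 2 3)) + 1/3 \<longleftrightarrow> d 2 1 * (3*z - 1) < d 2 3 * (2 - 3*z)"
    using less_third_quotient_iff[of "d 2 1" "d 2 3" "3*z - 1"] assms
    by (simp add: diff_divide_distrib diff_less_eq del: distrib_left_numeral)
  then show ?thesis using phi_nth_2[OF assms(1,2)] assms
    by (auto simp: server_choice_def server_target_def forall_3 ex_3 tie_tank_def)
qed

lemma server_choice_phi_3:
  assumes "2/3 \<le> z" "z \<le> 1" "d 3 2 > 0" "d 3 1 > 0"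
  shows "server_choice d (phi z) (if z < 1 / (3 * (1 + d 3 2 / d 3 1)) + 2/3 then 1 else 2)"
proof -
  have "z < 1 / (3 * (1 + d 3 2 / d 3 1)) + 2/3 \<longleftrightarrow> d 3 2 * (3*z - 2) < d 3 1 * (3 - 3*z)"
    using less_third_quotient_iff[of "d 3 2" "d 3 1" "3*z - 2"] assms
    by (simp add: diff_divide_distrib diff_less_eq del: distrib_left_numeral)
  then show ?thesis using phi_nth_3[OF assms(1,2)] assms
    by (auto simp: server_choice_def server_target_def forall_3 ex_3 tie_tank_def)
qed

section \<open>The branches of the interval map\<close>

lemma one_third_quotient_bounds:
  fixes a :: real
  assumes "a > 0"
  shows "0 < 1 / (3 * (1 + a))" "1 / (3 * (1 + a)) < 1/3"
  using assms by (simp_all add: field_simps)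

text \<open>Draining a tank passes half of its volume to each of the other two, whence the slope
  -1/2. The drained tank determines the side on which the image lies, and solving for its parameter
  gives the intercept 1/2 or 1.\<close>

lemma drain_phi:
  assumes "0 \<le> z" "z \<le> 1"
  shows "z \<le> 1/3 \<Longrightarrow> drain 2 (phi z) = phi (1/2 - z/2)"
    "z \<le> 1/3 \<Longrightarrow> drain 3 (phi z) = phi (1 - z/2)"
    "1/3 \<le> z \<Longrightarrow> z \<le> 2/3 \<Longrightarrow> drain 3 (phi z) = phi (1 - z/2)"
    "1/3 \<le> z \<Longrightarrow> z \<le> 2/3 \<Longrightarrow> drain 1 (phi z) = phi (1/2 - z/2)"
    "2/3 \<le> z \<Longrightarrow> drain 1 (phi z) = phi (1/2 - z/2)"
    "2/3 \<le> z \<Longrightarrow> drain 2 (phi z) = phi (1 - z/2)"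
  using assms phi_nth_1[of z] phi_nth_2[of z] phi_nth_3[of z]
    phi_nth_1[of "1/2 - z/2"] phi_nth_2[of "1/2 - z/2"]
    phi_nth_2[of "1 - z/2"] phi_nth_3[of "1 - z/2"]
  by (simp_all add: vec_eq_iff forall_3 drain_def drift_nth field_simps)

text \<open>Regroups the four pieces by sides: each side contains exactly one break point in its
  interior, and the two middle pieces run across the corners at 1/3 and 2/3.\<close>

lemma f_map_eq:
  assumes "d1 > 0" "d2 > 0" "d3 > 0"
  shows "0 \<le> z \<Longrightarrow> z \<le> 1/3 \<Longrightarrow>
           f_map d1 d2 d3 z = (if z < 1 / (3 * (1 + d1)) then 1/2 - z/2 else 1 - z/2)"
    and "1/3 \<le> z \<Longrightarrow> z \<le> 2/3 \<Longrightarrow>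
           f_map d1 d2 d3 z = (if z < 1 / (3 * (1 + d2)) + 1/3 then 1 - z/2 else 1/2 - z/2)"
    and "2/3 \<le> z \<Longrightarrow> z \<le> 1 \<Longrightarrow>
           f_map d1 d2 d3 z = (if z < 1 / (3 * (1 + d3)) + 2/3 then 1/2 - z/2 else 1 - z/2)"
proof -
  define q where "q a = 1 / (3 * (1 + a))" for a :: real
  have q: "0 < q d1" "q d1 < 1/3" "0 < q d2" "q d2 < 1/3" "0 < q d3" "q d3 < 1/3"
    using one_third_quotient_bounds assms by (simp_all only: q_def)
  have f: "f_map d1 d2 d3 z =
     (if z \<in> {0..<q d1} then - (1/2) * z + 1/2
      else if z \<in> {q d1..<q d2 + 1/3} then - (1/2) * z + 1
      else if z \<in> {q d2 + 1/3..<q d3 + 2/3} then - (1/2) * z + 1/2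
      else if z \<in> {q d3 + 2/3..1} then - (1/2) * z + 1
      else undefined)"
    by (simp only: f_map_def Let_def q_def)
  show "f_map d1 d2 d3 z = (if z < 1 / (3 * (1 + d1)) then 1/2 - z/2 else 1 - z/2)"
    if "0 \<le> z" "z \<le> 1/3"
    unfolding q_def[symmetric] using f q that by auto
  show "f_map d1 d2 d3 z = (if z < 1 / (3 * (1 + d2)) + 1/3 then 1 - z/2 else 1/2 - z/2)"
    if "1/3 \<le> z" "z \<le> 2/3"
    unfolding q_def[symmetric] using f q that by auto
  show "f_map d1 d2 d3 z = (if z < 1 / (3 * (1 + d3)) + 2/3 then 1/2 - z/2 else 1 - z/2)"
    if "2/3 \<le> z" "z \<le> 1"
    unfolding q_def[symmetric] using f q that by auto
qed

text \<open>The value 1 would need \<open>z = 0\<close> on a branch \<open>1 - z/2\<close>, and 0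
  would need \<open>z = 1\<close> on a branch \<open>1/2 - z/2\<close>; the break points in the
  first and last sides prevent this. Hence the image avoids the double point of
  \<open>phi\<close>.\<close>

lemma f_map_range:
  assumes d: "d1 > 0" "d2 > 0" "d3 > 0" and z: "0 \<le> z" "z \<le> 1"
  shows "0 < f_map d1 d2 d3 z" "f_map d1 d2 d3 z < 1"
proof -
  have "0 < f_map d1 d2 d3 z \<and> f_map d1 d2 d3 z < 1"
    using z
  proof (cases rule: unit_interval_thirds)
    case 1
    with one_third_quotient_bounds[OF d(1)] show ?thesis
      unfolding f_map_eq(1)[OF d 1] by (cases "z = 0") (auto simp: d)
  next
    case 2
    then show ?thesis unfolding f_map_eq(2)[OF d 2] by auto
  next
    case 3
    have "1 / (3 * (1 + d3)) + 2/3 < 1" using one_third_quotient_bounds[OF d(3)] by linarith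
    then have "z < 1" if "z < 1 / (3 * (1 + d3)) + 2/3" using that by (rule less_trans[rotated])
    with 3 show ?thesis unfolding f_map_eq(3)[OF d 3] by (simp del: distrib_left_numeral)
  qed
  then show "0 < f_map d1 d2 d3 z" "f_map d1 d2 d3 z < 1" by simp_all
qed

lemma poincare_map_phi:
  assumes pos: "\<And>i j. i \<noteq> j \<Longrightarrow> d i j > 0" and z: "0 \<le> z" "z \<le> 1"
  shows "poincare_map d (phi z) = phi (f_map (d 1 3 / d 1 2) (d 2 1 / d 2 3) (d 3 2 / d 3 1) z)"
proof -
  let ?d1 = "d 1 3 / d 1 2" and ?d2 = "d 2 1 / d 2 3" and ?d3 = "d 3 2 / d 3 1"
  have F: "poincare_map d (phi z) = drain j (phi z)" if "server_choice d (phi z) j" for j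
    using pos phi_in_boundary[OF z] that by (rule poincare_map_eq)
  have d: "?d1 > 0" "?d2 > 0" "?d3 > 0" using pos by simp_all
  from z show ?thesis
  proof (cases rule: unit_interval_thirds)
    case 1
    then have "poincare_map d (phi z) = drain (if z < 1 / (3 * (1 + ?d1)) then 2 else 3) (phi z)"
      using pos by (intro F server_choice_phi_1) auto
    also have "\<dots> = phi (if z < 1 / (3 * (1 + ?d1)) then 1/2 - z/2 else 1 - z/2)"
      using drain_phi[OF z] 1 by simp
    finally show ?thesis unfolding f_map_eq(1)[OF d 1] .
  next
    case 2
    then have "poincare_map d (phi z) = drain (if z < 1 / (3 * (1 + ?d2)) + 1/3 then 3 else 1) (phi z)"
      using pos by (intro F server_choice_phi_2) auto
    also have "\<dots> = phi (if z < 1 / (3 * (1 + ?d2)) + 1/3 then 1 - z/2 else 1/2 - z/2)"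
      using drain_phi[OF z] 2 by simp
    finally show ?thesis unfolding f_map_eq(2)[OF d 2] .
  next
    case 3
    then have "poincare_map d (phi z) = drain (if z < 1 / (3 * (1 + ?d3)) + 2/3 then 1 else 2) (phi z)"
      using pos by (intro F server_choice_phi_3) auto
    also have "\<dots> = phi (if z < 1 / (3 * (1 + ?d3)) + 2/3 then 1/2 - z/2 else 1 - z/2)"
      using drain_phi[OF z] 3 by simp
    finally show ?thesis unfolding f_map_eq(3)[OF d 3] .
  qed
qed

theorem lemma1p1:
  fixes d1 d2 d3 :: real and d :: "3 \<Rightarrow> 3 \<Rightarrow> real"
  assumes "d1 > 0" "d2 > 0" "d3 > 0"
    and "\<And>i j. i \<noteq> j \<Longrightarrow> d i j > 0"
    and "d 1 3 / d 1 2 = d1" "d 2 1 / d 2 3 = d2" "d 3 2 / d 3 1 = d3"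
  shows "conjugate_via_phi (poincare_map d) (f_map d1 d2 d3)"
proof -
  let ?f = "f_map d1 d2 d3"
  have range: "0 < ?f z" "?f z < 1" if "0 \<le> z" "z \<le> 1" for z
    using f_map_range assms(1-3) that by blast+
  have F: "poincare_map d (phi z) = phi (?f z)" if "0 \<le> z" "z \<le> 1" for z
    using poincare_map_phi[OF assms(4) that] assms(5-7) by simp
  have phi_0: "phi 0 = axis 2 1"
    by (simp add: phi_def)
  have "poincare_map d x \<in> state_boundary - {axis 2 1}" if x: "x \<in> state_boundary" for x
  proof -
    obtain z where z: "0 \<le> z" "z \<le> 1" "phi z = x" using phi_surj[OF x] .
    \<comment> \<open>\<open>?f z\<close> is an interior parameter, so it shares its point with no
      other parameter, in particular not with 0.\<close>
    have "phi (?f z) \<noteq> phi 0" using phi_inj[of "?f z" 0] range[OF z(1,2)] by force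
    moreover have "phi (?f z) \<in> state_boundary"
      using range[OF z(1,2)] by (intro phi_in_boundary) auto
    ultimately show ?thesis using F[OF z(1,2)] z(3) phi_0 by simp
  qed
  then show ?thesis
    unfolding conjugate_via_phi_def
    using range F phi_inv_phi by (auto simp: less_imp_le)
qed

end
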